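(* Fix $n$. Assume that $\rho(\cdot,y)$ is convex and Lipschitz with constant $L>0$ for each $y\in\{0,1\}$, that $X_{ij}\sim Subg(\sigma_{jn}^2)$ for $j=1,\dots,p_n$, that for some $\epsilon,\theta>0$ we have $R(b)-R(\beta^* )\ge\theta\|b-\beta^*\|_2^2$ for all $b\in\mathbb{R}^{p_n}$ such that $\operatorname{supp}b\subseteq s^*$ and $\|b-\beta^*\|_2\le\epsilon$, and that $8a_n|s^*|\le\theta n\min\{\epsilon^2,\beta^{*2}_{min}\}$. Then $$P\left(\min_{w\in\mathcal{M}:\,w\subsetneq s^*}GIC(w)\le GIC(s^* )\right)\le\frac{32Ls_n\sqrt{|s^*|}}{\theta\sqrt n\min\{\epsilon,\beta^*_{min}\}}.$$
   Context: $(X,Y)$ is a random element of $\mathbb{R}^{p_n}\times\{0,1\}$ (its law may depend on $n$) and $(X_i,Y_i)$, $i=1,\dots,n$, are iid copies of it, $X_i=(X_{i1},\dots,X_{ip_n})^T$. A random variable $Z$ is $Subg(\sigma^2)$ if $E\exp(tZ)\le\exp(t^2\sigma^2/2)$ for all $t\in\mathbb{R}$. $s_n=\max_{1\le j\le p_n}\sigma_{jn}$. Standing assumption: no nontrivial linear combination of the coordinates of $X$ is almost surely constant. For $\rho:\mathbb{R}\times\{0,1\}\to\mathbb{R}$ the risk and the empirical risk are $R(b)=E\rho(b^TX,Y)$ and $R_n(b)=\frac1n\sum_{i=1}^n\rho(b^TX_i,Y_i)$, $b\in\mathbb{R}^{p_n}$. $\beta^*=\arg\min_{b\in\mathbb{R}^{p_n}}R(b)$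 is assumed throughout to exist and be unique; $s^*=\operatorname{supp}\beta^*=\{i:\beta^*_i\ne0\}$, $\beta^*_{min}=\min_{i\in s^*}|\beta^*_i|$. $k_n$ is a deterministic positive integer and $\mathcal{M}\subseteq2^{\{1,\dots,p_n\}}$ is an arbitrary, possibly data-dependent (random), family of subsets ("models") such that almost surely $s^*\in\mathcal{M}$ and $|w|\le k_n$ for all $w\in\mathcal{M}$. For $w\subseteq\{1,\dots,p_n\}$, $\hat\beta(w)=\arg\min\{R_n(b):b\in\mathbb{R}^{p_n},\ \operatorname{supp}b\subseteq w\}$, and $$GIC(w)=nR_n(\hat\beta(w))+a_n|w|,$$ where $a_n>0$ is a given (deterministic) penalty. The minimum over an empty set is $+\infty$. *)

theory Defs
  imports "HOL-Probability.Probability"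
begin

text \<open>
  The coordinates \<open>1, \<dots>, p\<close> of the predictor are the elements of a finite type
  \<open>'p\<close>, and the response takes the values \<open>0\<close> and \<open>1\<close> of type \<^typ>\<open>nat\<close>.
\<close>

abbreviation obs_space :: "((real ^ 'p) \<times> nat) measure" where
  "obs_space \<equiv> borel \<Otimes>\<^sub>M count_space {0, 1}"

definition supp :: "real ^ 'p \<Rightarrow> 'p set" where
  "supp b = {j. b $ j \<noteq> 0}"

text \<open>Integrability is required because the Bochner integral of a non-integrable function is 0.\<close>

definition (in prob_space) subgaussian :: "('a \<Rightarrow> real) \<Rightarrow> real \<Rightarrow> bool" where
  "subgaussian Z v \<longleftrightarrow> random_variable borel Z \<and>
     (\<forall>t. integrable M (\<lambda>\<omega>. exp (t * Z \<omega>)) \<and>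
          expectation (\<lambda>\<omega>. exp (t * Z \<omega>)) \<le> exp (t\<^sup>2 * v / 2))"

definition risk :: "'a measure \<Rightarrow> (real \<Rightarrow> nat \<Rightarrow> real) \<Rightarrow> ('a \<Rightarrow> real ^ 'p) \<Rightarrow> ('a \<Rightarrow> nat)
    \<Rightarrow> real ^ 'p \<Rightarrow> real" where
  "risk M \<rho> X Y b = (\<integral>\<omega>. \<rho> (b \<bullet> X \<omega>) (Y \<omega>) \<partial>M)"

definition emp_risk :: "nat \<Rightarrow> (real \<Rightarrow> nat \<Rightarrow> real) \<Rightarrow> (nat \<Rightarrow> real ^ 'p) \<Rightarrow> (nat \<Rightarrow> nat)
    \<Rightarrow> real ^ 'p \<Rightarrow> real" where
  "emp_risk n \<rho> x y b = (1 / real n) * (\<Sum>i = 1..n. \<rho> (b \<bullet> x i) (y i))"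

text \<open>The argument \<open>bhat\<close> assigns to every model \<open>w\<close> a minimizer of the empirical risk over
  the vectors supported in \<open>w\<close>.\<close>

definition GIC :: "nat \<Rightarrow> real \<Rightarrow> (real \<Rightarrow> nat \<Rightarrow> real) \<Rightarrow> (nat \<Rightarrow> real ^ 'p) \<Rightarrow> (nat \<Rightarrow> nat)
    \<Rightarrow> ('p set \<Rightarrow> real ^ 'p) \<Rightarrow> 'p set \<Rightarrow> real" where
  "GIC n a \<rho> x y bhat w = real n * emp_risk n \<rho> x y (bhat w) + a * real (card w)"

text \<open>Minima over possibly empty finite sets are infima in \<^typ>\<open>ereal\<close>: they are attained if
  the set is nonempty, and equal \<open>\<infinity>\<close> if it is empty.\<close>

definition beta_min :: "real ^ 'p \<Rightarrow> ereal" where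
  "beta_min b = (INF j\<in>supp b. ereal \<bar>b $ j\<bar>)"

end

theory Submission
  imports Defs "HOL-Real_Asymp.Real_Asymp"
begin

text \<open>
  If a model \<open>w \<subset> supp \<beta>\<close> beats \<open>supp \<beta>\<close>, the empirical risk at \<open>\<beta>hat w\<close> exceeds that at \<open>\<beta>\<close> by at most
  \<open>a |supp \<beta>| / n \<le> \<theta> m\<^sup>2 / 8\<close>, where \<open>m = min \<epsilon> beta_min\<close>. By convexity the same holds at some \<open>u\<close>
  with \<open>supp u \<subseteq> supp \<beta>\<close> and \<open>norm (u - \<beta>) = m\<close>, where the true risk grows by at least \<open>\<theta> m\<^sup>2\<close>. So the
  centered empirical process deviates by more than \<open>\<theta> m\<^sup>2 / 2\<close> somewhere on a ball of radius \<open>m\<close>, and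
  Markov's inequality reduces the claim to a bound on its expected supremum.

  Symmetrization and contraction are done together, one observation at a time and without a ghost
  sample: the maximum of \<open>H + f - E f\<close> is at most the average of the maxima of \<open>H + 2 f\<close> and
  \<open>H - 2 E f\<close>; Jensen's inequality replaces \<open>E f\<close> by \<open>f\<close> in the second, and then the two-point
  contraction inequality replaces \<open>f\<close> by a linear function of \<open>u\<close>. The resulting Rademacher average
  is bounded by Cauchy-Schwarz.
\<close>

section \<open>Finite maxima, and integrating out one observation\<close>

text \<open>Midpoint convexity of the maximum, read off at a maximizer of \<open>f\<close>.\<close>

lemma MAX_midpoint_le:
  fixes f g h :: "'t \<Rightarrow> real"
  assumes "finite F" "F \<noteq> {}" "\<And>t. t \<in> F \<Longrightarrow> 2 * f t \<le> g t + h t"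
  shows "2 * (MAX t\<in>F. f t) \<le> (MAX t\<in>F. g t) + (MAX t\<in>F. h t)"
proof -
  have "(MAX t\<in>F. f t) \<in> f ` F"
    using assms by (intro Max_in) auto
  then obtain t where t: "t \<in> F" "(MAX t\<in>F. f t) = f t" by auto
  moreover have "g t \<le> (MAX t\<in>F. g t)" "h t \<le> (MAX t\<in>F. h t)"
    using t assms(1) by (auto intro!: Max_ge)
  ultimately show ?thesis using assms(3)[of t] by simp
qed

text \<open>Two-point form of the contraction principle for Rademacher averages: if \<open>s\<close>
  and \<open>t\<close> maximize the two terms on the left, their sum is at most
  \<open>h s + h t + \<bar>g s - g t\<bar>\<close>, and the sign of \<open>g s - g t\<close> decides
  which of \<open>s\<close> and \<open>t\<close> is inserted into which maximum on the
  right.\<close>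

lemma MAX_contraction:
  fixes h f g :: "'t \<Rightarrow> real"
  assumes F: "finite F" "F \<noteq> {}"
    and le: "\<And>s t. s \<in> F \<Longrightarrow> t \<in> F \<Longrightarrow> \<bar>f s - f t\<bar> \<le> \<bar>g s - g t\<bar>"
  shows "(MAX t\<in>F. h t + f t) + (MAX t\<in>F. h t - f t)
    \<le> (MAX t\<in>F. h t + g t) + (MAX t\<in>F. h t - g t)"
proof -
  have "(MAX t\<in>F. h t + f t) \<in> (\<lambda>t. h t + f t) ` F" "(MAX t\<in>F. h t - f t) \<in> (\<lambda>t. h t - f t) ` F"
    using F by (intro Max_in; simp)+
  then obtain s t where st: "s \<in> F" "t \<in> F"
    "(MAX t\<in>F. h t + f t) = h s + f s" "(MAX t\<in>F. h t - f t) = h t - f t" by auto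
  have "h u + g u \<le> (MAX t\<in>F. h t + g t)" "h u - g u \<le> (MAX t\<in>F. h t - g t)" if "u \<in> F" for u
    using that F by (auto intro!: Max_ge)
  from this[OF st(1)] this[OF st(2)] le[OF st(1,2)] show ?thesis
    unfolding st(3,4) by linarith
qed

lemma integrable_MAX:
  fixes f :: "'t \<Rightarrow> 'a \<Rightarrow> real"
  assumes "finite F" "F \<noteq> {}" "\<And>t. t \<in> F \<Longrightarrow> integrable M (f t)"
  shows "integrable M (\<lambda>x. MAX t\<in>F. f t x)"
  using assms by (induction rule: finite_ne_induct) auto

lemma integrable_if_const:
  "integrable M f \<Longrightarrow> integrable M g \<Longrightarrow> integrable M (\<lambda>x. if P then f x else g x)"
  by (cases P) simp_all

text \<open>Jensen's inequality, conditionally on the \<open>Z i\<close> with \<open>i \<noteq> j\<close>.\<close>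

lemma (in prob_space) expectation_MAX_integrate_out:
  fixes \<phi> :: "'i \<Rightarrow> 't \<Rightarrow> 'z \<Rightarrow> real"
  assumes indep: "indep_vars (\<lambda>_. N) Z I" and I: "finite I" "j \<in> I"
    and F: "finite F" "F \<noteq> {}"
    and [measurable]: "\<And>i t. \<phi> i t \<in> borel_measurable N"
    and int: "\<And>i t. i \<in> I \<Longrightarrow> t \<in> F \<Longrightarrow> integrable M (\<lambda>\<omega>. \<phi> i t (Z i \<omega>))"
  shows "expectation (\<lambda>\<omega>. MAX t\<in>F. (\<Sum>i\<in>I - {j}. \<phi> i t (Z i \<omega>)) + expectation (\<lambda>\<omega>. \<phi> j t (Z j \<omega>)))
    \<le> expectation (\<lambda>\<omega>. MAX t\<in>F. \<Sum>i\<in>I. \<phi> i t (Z i \<omega>))"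
proof -
  define J where "J = I - {j}"
  define W where "W = (\<lambda>\<omega>. restrict (\<lambda>i. Z i \<omega>) J)"
  define h where "h t w = (\<Sum>i\<in>J. \<phi> i t (w i))" for t and w :: "'i \<Rightarrow> 'z"
  \<comment> \<open>Independence is used for blocks of coordinates, so the single observation
    \<open>Z j\<close> is carried as a restriction to \<open>{j}\<close>, while \<open>W\<close>
    holds the remaining ones.\<close>
  define V where "V = (\<lambda>\<omega>. restrict (\<lambda>i. Z i \<omega>) {j})"
  define g where "g t w = \<phi> j t (w j)" for t and w :: "'i \<Rightarrow> 'z"
  let ?P = "PiM J (\<lambda>_. N)"
  let ?Q = "distr M ?P W"
  let ?P' = "PiM {j} (\<lambda>_. N)"
  let ?R = "distr M ?P' V"
  have J: "finite J" "I = insert j J" "j \<notin> J"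
    using I by (auto simp: J_def)
  have rv: "random_variable N (Z i)" if "i \<in> I" for i
    using indep that by (auto simp: indep_vars_def)
  have [measurable]: "random_variable N (Z j)" using rv I by auto
  have [measurable]: "random_variable ?P W"
    unfolding W_def using rv J by (intro measurable_restrict) auto
  have [measurable]: "random_variable ?P' V"
    unfolding V_def using rv I by (intro measurable_restrict) auto
  have gm [measurable]: "g t \<in> borel_measurable ?P'" for t
    unfolding g_def by measurable
  have hm [measurable]: "h t \<in> borel_measurable ?P" for t
    unfolding h_def by measurable
  have "indep_var ?P W ?P' V"
    unfolding W_def V_def by (rule indep_var_restrict[OF indep]) (use I in \<open>auto simp: J_def\<close>)
  then have joint: "?Q \<Otimes>\<^sub>M ?R = distr M (?P \<Otimes>\<^sub>M ?P') (\<lambda>\<omega>. (W \<omega>, V \<omega>))"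
    unfolding indep_var_distribution_eq by simp
  have gV: "g t (V \<omega>) = \<phi> j t (Z j \<omega>)" for t \<omega>
    by (simp add: g_def V_def)
  interpret Q: prob_space ?Q by (rule prob_space_distr) simp
  interpret R: prob_space ?R by (rule prob_space_distr) simp
  interpret QR: pair_prob_space ?Q ?R ..
  have hW: "h t (W \<omega>) = (\<Sum>i\<in>J. \<phi> i t (Z i \<omega>))" for t \<omega>
    unfolding h_def W_def by (intro sum.cong) auto
  have int_h: "integrable M (\<lambda>\<omega>. h t (W \<omega>))" if "t \<in> F" for t
    unfolding hW using int that J by auto
  have int_g: "integrable ?R (g t)" if "t \<in> F" for t
    using int that I by (subst integrable_distr_eq) (auto simp: gV)
  \<comment> \<open>Integrability on the product, needed for Fubini, is pulled back to
    \<open>M\<close> along \<open>joint\<close>.\<close>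
  have int_all: "integrable (?Q \<Otimes>\<^sub>M ?R) (\<lambda>p. MAX t\<in>F. h t (fst p) + g t (snd p))"
    unfolding joint using int_h int I F
    by (subst integrable_distr_eq) (auto simp: gV intro!: integrable_MAX)
  have "expectation (\<lambda>\<omega>. MAX t\<in>F. (\<Sum>i\<in>J. \<phi> i t (Z i \<omega>)) + expectation (\<lambda>\<omega>. \<phi> j t (Z j \<omega>)))
      = (\<integral>w. (MAX t\<in>F. h t w + (\<integral>y. g t y \<partial>?R)) \<partial>?Q)"
    using F by (subst (1 2) integral_distr) (auto simp: hW gV)
  \<comment> \<open>For fixed \<open>w\<close> the maximum over \<open>t\<close> is moved inside the
    integral over \<open>y\<close>: Jensen's inequality for the maximum.\<close>
  also have "\<dots> \<le> (\<integral>w. (\<integral>y. (MAX t\<in>F. h t w + g t y) \<partial>?R) \<partial>?Q)"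
  proof (rule integral_mono)
    show "integrable ?Q (\<lambda>w. MAX t\<in>F. h t w + (\<integral>y. g t y \<partial>?R))"
      using F int_h by (intro integrable_MAX Bochner_Integration.integrable_add)
        (auto simp: integrable_distr_eq)
    show "integrable ?Q (\<lambda>w. \<integral>y. (MAX t\<in>F. h t w + g t y) \<partial>?R)"
      using QR.integrable_fst'[OF int_all] by simp
    fix w
    have "h t w + (\<integral>y. g t y \<partial>?R) \<le> (\<integral>y. (MAX t\<in>F. h t w + g t y) \<partial>?R)" if t: "t \<in> F" for t
    proof -
      have "h t w + (\<integral>y. g t y \<partial>?R) = (\<integral>y. h t w + g t y \<partial>?R)"
        using int_g[OF t] R.prob_space by simp
      also have "\<dots> \<le> (\<integral>y. (MAX t\<in>F. h t w + g t y) \<partial>?R)"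
        using int_g t F by (intro integral_mono integrable_MAX) (auto intro!: Max_ge)
      finally show ?thesis .
    qed
    then show "(MAX t\<in>F. h t w + (\<integral>y. g t y \<partial>?R)) \<le> (\<integral>y. (MAX t\<in>F. h t w + g t y) \<partial>?R)"
      using F by simp
  qed
  also have "\<dots> = (\<integral>p. (MAX t\<in>F. h t (fst p) + g t (snd p)) \<partial>(?Q \<Otimes>\<^sub>M ?R))"
    using QR.integral_fst'[OF int_all] by simp
  also have "\<dots> = expectation (\<lambda>\<omega>. MAX t\<in>F. h t (W \<omega>) + g t (V \<omega>))"
    unfolding joint using F by (subst integral_distr) auto
  also have "\<dots> = expectation (\<lambda>\<omega>. MAX t\<in>F. \<Sum>i\<in>I. \<phi> i t (Z i \<omega>))"
    using J by (simp add: hW gV add.commute)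
  finally show ?thesis by (simp add: J_def)
qed

section \<open>Rademacher averages as sums over sign vectors\<close>

text \<open>A subset \<open>S\<close> of the indices encodes a sign vector with plus signs on
  \<open>S\<close>. Splitting by whether \<open>a\<close> is in \<open>S\<close> separates off one
  sign.\<close>

lemma sum_Pow_insert:
  assumes "finite A" "a \<notin> A"
  shows "(\<Sum>S\<in>Pow (insert a A). f S) = (\<Sum>S\<in>Pow A. f S + f (insert a S))"
proof -
  have "inj_on (insert a) (Pow A)" using assms by (auto simp: inj_on_def)
  moreover have "Pow A \<inter> insert a ` Pow A = {}" using assms by auto
  ultimately show ?thesis
    using assms by (simp add: Pow_insert sum.union_disjoint sum.reindex sum.distrib)
qed

text \<open>Orthogonality of random signs: for each new index the parallelogram law cancels the
  cross terms. The factor \<open>2 ^ card I\<close> counts the sign vectors, as sums stand in for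
  averages.\<close>

lemma sum_norm_signed_sum:
  fixes x :: "'i \<Rightarrow> 'v::real_inner"
  assumes "finite I"
  shows "(\<Sum>S\<in>Pow I. (norm (\<Sum>i\<in>I. if i \<in> S then x i else - x i))\<^sup>2) = 2 ^ card I * (\<Sum>i\<in>I. (norm (x i))\<^sup>2)"
  using assms
proof (induction I)
  case (insert a A)
  let ?v = "\<lambda>S. \<Sum>i\<in>A. if i \<in> S then x i else - x i"
  have v: "(\<Sum>i\<in>A. if i = a \<or> i \<in> S then x i else - x i) = ?v S" for S
    using insert by (intro sum.cong) auto
  have "(\<Sum>S\<in>Pow (insert a A). (norm (\<Sum>i\<in>insert a A. if i \<in> S then x i else - x i))\<^sup>2)
     = (\<Sum>S\<in>Pow A. (norm (- x a + ?v S))\<^sup>2 + (norm (x a + ?v S))\<^sup>2)"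
    unfolding sum_Pow_insert[OF insert(1,2)] using insert(1,2)
    by (intro sum.cong refl) (auto simp: v)
  also have "\<dots> = (\<Sum>S\<in>Pow A. 2 * (norm (?v S))\<^sup>2 + 2 * (norm (x a))\<^sup>2)"
    by (intro sum.cong refl) (simp add: power2_norm_eq_inner algebra_simps inner_commute)
  also have "\<dots> = 2 ^ card (insert a A) * (\<Sum>i\<in>insert a A. (norm (x i))\<^sup>2)"
    using insert by (simp add: sum.distrib sum_distrib_left[symmetric] card_Pow algebra_simps)
  finally show ?case .
qed simp

text \<open>Cauchy-Schwarz over the \<open>2 ^ card I\<close> sign vectors turns the second moment
  into a bound on the first.\<close>

lemma sum_norm_signed_sum_le:
  fixes x :: "'i \<Rightarrow> 'v::real_inner"
  assumes "finite I"
  shows "(\<Sum>S\<in>Pow I. norm (\<Sum>i\<in>I. if i \<in> S then x i else - x i)) \<le> 2 ^ card I * sqrt (\<Sum>i\<in>I. (norm (x i))\<^sup>2)"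
proof (rule power2_le_imp_le)
  have "(\<Sum>S\<in>Pow I. norm (\<Sum>i\<in>I. if i \<in> S then x i else - x i))\<^sup>2
      \<le> (2 ^ card I * (\<Sum>i\<in>I. (norm (x i))\<^sup>2)) * card (Pow I)"
    unfolding sum_norm_signed_sum[OF assms, symmetric] by (rule sum_squared_le_sum_of_squares)
  also have "\<dots> = (2 ^ card I * sqrt (\<Sum>i\<in>I. (norm (x i))\<^sup>2))\<^sup>2"
    using assms by (simp add: card_Pow power_mult_distrib sum_nonneg) (simp add: power2_eq_square)
  finally show "(\<Sum>S\<in>Pow I. norm (\<Sum>i\<in>I. if i \<in> S then x i else - x i))\<^sup>2
      \<le> (2 ^ card I * sqrt (\<Sum>i\<in>I. (norm (x i))\<^sup>2))\<^sup>2" .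
qed (simp add: sum_nonneg)

section \<open>Second moments of subgaussian variables\<close>

text \<open>The variance is nonnegative.\<close>

lemma (in prob_space) expectation_le_sqrt:
  assumes "integrable M Z" "integrable M (\<lambda>\<omega>. (Z \<omega>)\<^sup>2)"
  shows "expectation Z \<le> sqrt (expectation (\<lambda>\<omega>. (Z \<omega>)\<^sup>2))"
proof -
  have "(expectation Z)\<^sup>2 \<le> expectation (\<lambda>\<omega>. (Z \<omega>)\<^sup>2)"
    using variance_eq[OF assms] variance_positive[of Z] by simp
  then show ?thesis by (rule real_le_rsqrt)
qed

text \<open>Adding the exponential bounds at \<open>s\<close> and \<open>- s\<close> removes the
  linear term: \<open>2 + (s Z)^2 \<le> exp (s Z) + exp (- s Z)\<close> bounds the second moment by
  \<open>2 (exp (s^2 v / 2) - 1) / s^2\<close>, which tends to \<open>v\<close> as \<open>s\<close>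
  decreases to 0.\<close>

lemma (in prob_space) subgaussian_second_moment:
  assumes "subgaussian Z v" "v \<ge> 0"
  shows "integrable M (\<lambda>\<omega>. (Z \<omega>)\<^sup>2)" "expectation (\<lambda>\<omega>. (Z \<omega>)\<^sup>2) \<le> v"
proof -
  have [measurable]: "random_variable borel Z"
    and int: "integrable M (\<lambda>\<omega>. exp (t * Z \<omega>))"
    and le: "expectation (\<lambda>\<omega>. exp (t * Z \<omega>)) \<le> exp (t\<^sup>2 * v / 2)" for t
    using assms by (auto simp: subgaussian_def)
  have cosh: "2 + x\<^sup>2 \<le> exp x + exp (- x)" for x :: real
  proof -
    have "2 + y\<^sup>2 \<le> exp y + exp (- y)" if "y \<ge> 0" for y :: real
    proof -
      \<comment> \<open>The Lagrange remainder of order 4 is nonnegative for either sign of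
        \<open>x\<close>. At \<open>y\<close> and \<open>- y\<close> the odd powers then cancel and
        the quadratic terms add up to \<open>y^2\<close>.\<close>
      have "(\<Sum>k<4. x ^ k / fact k) \<le> exp x" for x :: real
      proof -
        obtain t where "exp x = (\<Sum>k<4. x ^ k / fact k) + exp t / fact 4 * x ^ 4"
          using Maclaurin_exp_le[of x 4] by blast
        then show ?thesis by simp
      qed
      from this[of y] this[of "- y"] show ?thesis
        by (simp add: eval_nat_numeral)
    qed
    from this[of "\<bar>x\<bar>"] show ?thesis by (cases "x \<ge> 0") auto
  qed
  show int2: "integrable M (\<lambda>\<omega>. (Z \<omega>)\<^sup>2)"
    using int[of 1] int[of "-1"]
  proof (rule Bochner_Integration.integrable_bound[OF Bochner_Integration.integrable_add])
    show "AE \<omega> in M. norm ((Z \<omega>)\<^sup>2) \<le> norm (exp (1 * Z \<omega>) + exp (- 1 * Z \<omega>))"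
    proof (rule AE_I2)
      fix \<omega> show "norm ((Z \<omega>)\<^sup>2) \<le> norm (exp (1 * Z \<omega>) + exp (- 1 * Z \<omega>))"
        using cosh[of "Z \<omega>"] by simp
    qed
  qed simp
  have bound: "expectation (\<lambda>\<omega>. (Z \<omega>)\<^sup>2) \<le> 2 * (exp (s\<^sup>2 * v / 2) - 1) / s\<^sup>2" if "s > 0" for s
  proof -
    have "2 + s\<^sup>2 * expectation (\<lambda>\<omega>. (Z \<omega>)\<^sup>2) = expectation (\<lambda>\<omega>. 2 + (s * Z \<omega>)\<^sup>2)"
      using int2 prob_space by (simp add: power_mult_distrib)
    also have "\<dots> \<le> expectation (\<lambda>\<omega>. exp (s * Z \<omega>) + exp ((- s) * Z \<omega>))"
      using int2 cosh[of "s * Z _"]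
      by (intro integral_mono Bochner_Integration.integrable_add int) (auto simp: power_mult_distrib)
    also have "\<dots> \<le> 2 * exp (s\<^sup>2 * v / 2)"
      using le[of s] le[of "- s"] int[of s] int[of "- s"] by simp
    finally show ?thesis using that by (simp add: field_simps)
  qed
  \<comment> \<open>For \<open>v = 0\<close> the function is identically 0; otherwise the limit
    comes from the derivative of \<open>exp\<close> at 0.\<close>
  have "((\<lambda>s. 2 * (exp (s\<^sup>2 * v / 2) - 1) / s\<^sup>2) \<longlongrightarrow> v) (at_right 0)"
  proof (cases "v = 0")
    case False
    with assms(2) have "v > 0" by simp
    then show ?thesis by real_asymp
  qed simp
  then show "expectation (\<lambda>\<omega>. (Z \<omega>)\<^sup>2) \<le> v"
    by (rule tendsto_lowerbound) (auto intro!: eventually_mono[OF eventually_at_right_less] dest: bound)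
qed

section \<open>Symmetrization and contraction\<close>

text \<open>Each step replaces the centered term of one observation by the signed terms
  \<open>2 g\<close> and \<open>- 2 g\<close>, averaged over a new sign; after \<open>card I\<close>
  steps every observation carries a sign.\<close>

lemma (in prob_space) symmetrization_contraction:
  fixes f g :: "'t \<Rightarrow> 'z \<Rightarrow> real" and Z :: "'i \<Rightarrow> 'a \<Rightarrow> 'z"
  assumes indep: "indep_vars (\<lambda>_. N) Z I" and I: "finite I"
    and F: "finite F" "F \<noteq> {}"
    and [measurable]: "\<And>t. f t \<in> borel_measurable N" "\<And>t. g t \<in> borel_measurable N"
    and int_f: "\<And>i t. i \<in> I \<Longrightarrow> t \<in> F \<Longrightarrow> integrable M (\<lambda>\<omega>. f t (Z i \<omega>))"
    and int_g: "\<And>i t. i \<in> I \<Longrightarrow> t \<in> F \<Longrightarrow> integrable M (\<lambda>\<omega>. g t (Z i \<omega>))"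
    and contr: "\<And>s t z. s \<in> F \<Longrightarrow> t \<in> F \<Longrightarrow> z \<in> space N \<Longrightarrow> \<bar>f s z - f t z\<bar> \<le> \<bar>g s z - g t z\<bar>"
  shows "2 ^ card I * expectation (\<lambda>\<omega>. MAX t\<in>F. \<Sum>i\<in>I. f t (Z i \<omega>) - expectation (\<lambda>\<omega>. f t (Z i \<omega>)))
    \<le> (\<Sum>S\<in>Pow I. expectation (\<lambda>\<omega>. MAX t\<in>F. \<Sum>i\<in>I. if i \<in> S then 2 * g t (Z i \<omega>) else - (2 * g t (Z i \<omega>))))"
proof -
  define c where "c i t z = f t z - expectation (\<lambda>\<omega>. f t (Z i \<omega>))" for i t z
  \<comment> \<open>Interpolating family: indices in \<open>K\<close> are already processed and
    carry the sign given by \<open>S\<close>, the others still carry the centered \<open>f\<close>.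
    So \<open>E {} {}\<close> is the quantity to bound, and the \<open>E I S\<close> are the signed
    expectations at the end.\<close>
  define \<psi> where "\<psi> K S i t z = (if i \<in> K then if i \<in> S then 2 * g t z else - (2 * g t z) else c i t z)"
    for K S :: "'i set" and i t z
  define E where "E K S = expectation (\<lambda>\<omega>. MAX t\<in>F. \<Sum>i\<in>I. \<psi> K S i t (Z i \<omega>))" for K S
  have \<psi>_m: "\<psi> K S i t \<in> borel_measurable N" for K S i t
    unfolding \<psi>_def c_def by (cases "i \<in> K"; cases "i \<in> S") simp_all
  have \<psi>_int: "integrable M (\<lambda>\<omega>. \<psi> K S i t (Z i \<omega>))" if "i \<in> I" "t \<in> F" for K S i t
    unfolding \<psi>_def c_def using int_f[OF that] int_g[OF that] by (cases "i \<in> K"; cases "i \<in> S") simp_all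
  have step: "2 * E K S \<le> E (insert j K) S + E (insert j K) (insert j S)"
    if K: "K \<subseteq> I" "S \<subseteq> K" and j: "j \<in> I" "j \<notin> K" for K S j
  proof -
    define H where "H t \<omega> = (\<Sum>i\<in>I - {j}. \<psi> K S i t (Z i \<omega>))" for t \<omega>
    note int_f' = int_f[OF j(1)] and int_g' = int_g[OF j(1)]
    have int_H: "integrable M (H t)" if "t \<in> F" for t
      unfolding H_def using \<psi>_int that by auto
    have I_eq: "(\<Sum>i\<in>I. u i) = (\<Sum>i\<in>I - {j}. u i) + u j" for u :: "'i \<Rightarrow> real"
      using I j by (simp add: sum.remove[of I j])
    have E1: "E K S = expectation (\<lambda>\<omega>. MAX t\<in>F. H t \<omega> + c j t (Z j \<omega>))"
      unfolding E_def I_eq H_def using j by (simp add: \<psi>_def)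
    have "\<psi> (insert j K) S i t z = \<psi> K S i t z" "\<psi> (insert j K) (insert j S) i t z = \<psi> K S i t z"
      if "i \<in> I - {j}" for i t z
      using that by (auto simp: \<psi>_def)
    moreover have "\<psi> (insert j K) S j t z = - (2 * g t z)" "\<psi> (insert j K) (insert j S) j t z = 2 * g t z" for t z
      using K j by (auto simp: \<psi>_def)
    ultimately have E2: "E (insert j K) S = expectation (\<lambda>\<omega>. MAX t\<in>F. H t \<omega> - 2 * g t (Z j \<omega>))"
      and E3: "E (insert j K) (insert j S) = expectation (\<lambda>\<omega>. MAX t\<in>F. H t \<omega> + 2 * g t (Z j \<omega>))"
      unfolding E_def I_eq H_def by simp_all
    \<comment> \<open>With \<open>- 2 f\<close> placed at index \<open>j\<close>, integrating out
      says that replacing the constant \<open>- 2 E f\<close> by the random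
      \<open>- 2 f (Z j)\<close> does not decrease the expected maximum.\<close>
    define \<phi> where "\<phi> i t z = (if i = j then - 2 * f t z else \<psi> K S i t z)" for i t z
    have \<phi>H: "(\<Sum>i\<in>I - {j}. \<phi> i t (Z i \<omega>)) = H t \<omega>" for t \<omega>
      unfolding H_def \<phi>_def by (intro sum.cong) auto
    have intout: "expectation (\<lambda>\<omega>. MAX t\<in>F. H t \<omega> + expectation (\<lambda>\<omega>. \<phi> j t (Z j \<omega>)))
        \<le> expectation (\<lambda>\<omega>. MAX t\<in>F. H t \<omega> + \<phi> j t (Z j \<omega>))"
    proof (rule expectation_MAX_integrate_out[OF indep I j(1) F, of \<phi>, unfolded I_eq \<phi>H])
      show "\<phi> i t \<in> borel_measurable N" for i t
        unfolding \<phi>_def using \<psi>_m by (cases "i = j") simp_all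
      show "integrable M (\<lambda>\<omega>. \<phi> i t (Z i \<omega>))" if "i \<in> I" "t \<in> F" for i t
        unfolding \<phi>_def using int_f[OF that] \<psi>_int[OF that] by (cases "i = j") simp_all
    qed
    have "2 * E K S = expectation (\<lambda>\<omega>. 2 * (MAX t\<in>F. H t \<omega> + c j t (Z j \<omega>)))"
      unfolding E1 by simp
    \<comment> \<open>\<open>H + f - E f\<close> is the midpoint of \<open>H + 2 f\<close> and
      \<open>H - 2 E f\<close>; the factor 2 in front of \<open>g\<close> originates here.\<close>
    also have "\<dots> \<le> expectation (\<lambda>\<omega>. (MAX t\<in>F. H t \<omega> + 2 * f t (Z j \<omega>))
        + (MAX t\<in>F. H t \<omega> + expectation (\<lambda>\<omega>. \<phi> j t (Z j \<omega>))))"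
      using int_H int_f' F
      by (intro integral_mono integrable_mult_right Bochner_Integration.integrable_add
          integrable_MAX MAX_midpoint_le) (auto simp: c_def \<phi>_def)
    also have "\<dots> = expectation (\<lambda>\<omega>. MAX t\<in>F. H t \<omega> + 2 * f t (Z j \<omega>))
        + expectation (\<lambda>\<omega>. MAX t\<in>F. H t \<omega> + expectation (\<lambda>\<omega>. \<phi> j t (Z j \<omega>)))"
      using int_H int_f' F
      by (intro Bochner_Integration.integral_add integrable_MAX) auto
    also have "\<dots> \<le> expectation (\<lambda>\<omega>. MAX t\<in>F. H t \<omega> + 2 * f t (Z j \<omega>))
        + expectation (\<lambda>\<omega>. MAX t\<in>F. H t \<omega> - 2 * f t (Z j \<omega>))"
      using intout by (simp add: \<phi>_def)
    also have "\<dots> = expectation (\<lambda>\<omega>. (MAX t\<in>F. H t \<omega> + 2 * f t (Z j \<omega>))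
        + (MAX t\<in>F. H t \<omega> - 2 * f t (Z j \<omega>)))"
      using int_H int_f' F
      by (intro Bochner_Integration.integral_add[symmetric] integrable_MAX) auto
    \<comment> \<open>Both maxima now contain the same observation \<open>Z j \<omega>\<close>, so
      the two-point contraction applies pointwise in \<open>\<omega>\<close>.\<close>
    also have "\<dots> \<le> expectation (\<lambda>\<omega>. (MAX t\<in>F. H t \<omega> + 2 * g t (Z j \<omega>))
        + (MAX t\<in>F. H t \<omega> - 2 * g t (Z j \<omega>)))"
    proof (intro integral_mono Bochner_Integration.integrable_add integrable_MAX
        Bochner_Integration.integrable_diff MAX_contraction F integrable_mult_right int_H int_f' int_g')
      fix \<omega> s t assume "\<omega> \<in> space M" "s \<in> F" "t \<in> F"
      moreover have "Z j \<in> M \<rightarrow>\<^sub>M N" using indep j by (auto simp: indep_vars_def)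
      ultimately show "\<bar>2 * f s (Z j \<omega>) - 2 * f t (Z j \<omega>)\<bar> \<le> \<bar>2 * g s (Z j \<omega>) - 2 * g t (Z j \<omega>)\<bar>"
        using contr[of s t "Z j \<omega>"] measurable_space[of "Z j" M N \<omega>] by simp
    qed
    also have "\<dots> = E (insert j K) S + E (insert j K) (insert j S)"
      unfolding E2 E3 using int_H int_g' F
      by (subst Bochner_Integration.integral_add) (auto intro!: integrable_MAX)
    finally show ?thesis .
  qed
  \<comment> \<open>Every new index doubles the number of sign vectors, matching the factor 2 in
    \<open>step\<close>.\<close>
  have "2 ^ card K * E {} {} \<le> (\<Sum>S\<in>Pow K. E K S)" if "K \<subseteq> I" for K
    using finite_subset[OF that I] that
  proof (induction K)
    case (insert j K)
    have "2 ^ card (insert j K) * E {} {} \<le> (\<Sum>S\<in>Pow K. 2 * E K S)"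
      using insert by (simp add: sum_distrib_left[symmetric])
    also have "\<dots> \<le> (\<Sum>S\<in>Pow K. E (insert j K) S + E (insert j K) (insert j S))"
      using insert by (intro sum_mono step) auto
    also have "\<dots> = (\<Sum>S\<in>Pow (insert j K). E (insert j K) S)"
      using insert by (simp add: sum_Pow_insert)
    finally show ?case .
  qed simp
  from this[of I] show ?thesis by (simp add: E_def \<psi>_def c_def)
qed

section \<open>Expected maximum and tail of the centered process on a ball\<close>

text \<open>After contraction, the signed sum is the inner product of \<open>u - \<beta>\<close>
  with a vector not involving \<open>u\<close>, so Cauchy-Schwarz bounds the maximum by a multiple
  of \<open>m\<close> times a norm. Averaging over the signs and Jensen's inequality for the square
  root leave only second moments.\<close>

lemma (in prob_space) expectation_MAX_centered_le:
  fixes f :: "'v::euclidean_space \<Rightarrow> 'z \<Rightarrow> real" and Z :: "'i \<Rightarrow> 'a \<Rightarrow> 'z" and x :: "'z \<Rightarrow> 'v"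
  assumes indep: "indep_vars (\<lambda>_. N) Z I" and I: "finite I"
    and F: "finite F" "F \<noteq> {}" "F \<subseteq> cball \<beta> m"
    and [measurable]: "\<And>u. f u \<in> borel_measurable N" "x \<in> borel_measurable N"
    and int_f: "\<And>i u. i \<in> I \<Longrightarrow> u \<in> F \<Longrightarrow> integrable M (\<lambda>\<omega>. f u (Z i \<omega>))"
    and int_x: "\<And>i. i \<in> I \<Longrightarrow> integrable M (\<lambda>\<omega>. (norm (x (Z i \<omega>)))\<^sup>2)"
    and B: "\<And>i. i \<in> I \<Longrightarrow> expectation (\<lambda>\<omega>. (norm (x (Z i \<omega>)))\<^sup>2) \<le> B"
    and L: "L \<ge> 0"
    and Lip: "\<And>u v z. u \<in> F \<Longrightarrow> v \<in> F \<Longrightarrow> z \<in> space N \<Longrightarrow> \<bar>f u z - f v z\<bar> \<le> L * \<bar>(u - v) \<bullet> x z\<bar>"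
  shows "expectation (\<lambda>\<omega>. MAX u\<in>F. \<Sum>i\<in>I. f u (Z i \<omega>) - expectation (\<lambda>\<omega>. f u (Z i \<omega>)))
    \<le> 2 * L * m * sqrt (real (card I) * B)"
proof -
  \<comment> \<open>Contraction sees only differences of \<open>g\<close>, so the linear function
    may be centered at \<open>\<beta>\<close>; this brings in the radius \<open>m\<close>.\<close>
  define g where "g u z = L * ((u - \<beta>) \<bullet> x z)" for u z
  define V where "V S \<omega> = (\<Sum>i\<in>I. if i \<in> S then x (Z i \<omega>) else - x (Z i \<omega>))" for S \<omega>
  define Q where "Q \<omega> = (\<Sum>i\<in>I. (norm (x (Z i \<omega>)))\<^sup>2)" for \<omega>
  have m: "m \<ge> 0" using F by (metis cball_eq_empty linorder_not_le subset_empty)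
  have Zm [measurable]: "Z i \<in> M \<rightarrow>\<^sub>M N" if "i \<in> I" for i
    using indep that by (auto simp: indep_vars_def)
  have int_n: "integrable M (\<lambda>\<omega>. norm (x (Z i \<omega>)))" if "i \<in> I" for i
  proof (rule square_integrable_imp_integrable[OF _ int_x[OF that]])
    have "Z i \<in> M \<rightarrow>\<^sub>M N" using Zm that by simp
    then show "(\<lambda>\<omega>. norm (x (Z i \<omega>))) \<in> borel_measurable M" by measurable
  qed
  then have int_xZ: "integrable M (\<lambda>\<omega>. x (Z i \<omega>))" if "i \<in> I" for i
  proof -
    have "Z i \<in> M \<rightarrow>\<^sub>M N" using Zm that by simp
    then have "(\<lambda>\<omega>. x (Z i \<omega>)) \<in> borel_measurable M" by measurable
    then show ?thesis using int_n[OF that] by (simp add: integrable_norm_iff)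
  qed
  have int_V: "integrable M (V S)" for S
    unfolding V_def using int_xZ by (intro Bochner_Integration.integrable_sum integrable_if_const) simp_all
  have int_Q: "integrable M Q"
    unfolding Q_def using int_x by auto
  \<comment> \<open>A crude bound that serves only the integrability of
    \<open>sqrt (Q \<omega>)\<close>.\<close>
  have sqrt_le: "sqrt y \<le> 1 + y" if "y \<ge> 0" for y :: real
    using that by (intro real_le_lsqrt) (auto simp: power2_eq_square algebra_simps)
  have int_sQ: "integrable M (\<lambda>\<omega>. sqrt (Q \<omega>))"
  proof (rule Bochner_Integration.integrable_bound[OF Bochner_Integration.integrable_add[OF _ int_Q]])
    show "AE \<omega> in M. norm (sqrt (Q \<omega>)) \<le> norm (1 + Q \<omega>)"
      using sqrt_le by (auto simp: Q_def sum_nonneg)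
  qed (use int_Q in auto)
  have "2 ^ card I * expectation (\<lambda>\<omega>. MAX u\<in>F. \<Sum>i\<in>I. f u (Z i \<omega>) - expectation (\<lambda>\<omega>. f u (Z i \<omega>)))
    \<le> (\<Sum>S\<in>Pow I. expectation (\<lambda>\<omega>. MAX u\<in>F. \<Sum>i\<in>I. if i \<in> S then 2 * g u (Z i \<omega>) else - (2 * g u (Z i \<omega>))))"
  proof (rule symmetrization_contraction[OF indep I F(1,2)])
    show "\<bar>f u z - f v z\<bar> \<le> \<bar>g u z - g v z\<bar>" if "u \<in> F" "v \<in> F" "z \<in> space N" for u v z
    proof -
      have "g u z - g v z = L * ((u - v) \<bullet> x z)" by (simp add: g_def algebra_simps)
      then show ?thesis using Lip[OF that] L by (simp add: abs_mult)
    qed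
  qed (use int_f int_xZ in \<open>auto simp: g_def\<close>)
  also have "\<dots> \<le> (\<Sum>S\<in>Pow I. expectation (\<lambda>\<omega>. 2 * L * m * norm (V S \<omega>)))"
  proof (intro sum_mono integral_mono integrable_mult_right integrable_norm int_V integrable_MAX F)
    show "integrable M (\<lambda>\<omega>. \<Sum>i\<in>I. if i \<in> S then 2 * g u (Z i \<omega>) else - (2 * g u (Z i \<omega>)))" for S u
      using int_xZ by (intro Bochner_Integration.integrable_sum integrable_if_const) (simp_all add: g_def)
    fix S \<omega>
    have "(\<Sum>i\<in>I. if i \<in> S then 2 * g u (Z i \<omega>) else - (2 * g u (Z i \<omega>))) \<le> 2 * L * m * norm (V S \<omega>)"
      if u: "u \<in> F" for u
    proof -
      have "(\<Sum>i\<in>I. if i \<in> S then 2 * g u (Z i \<omega>) else - (2 * g u (Z i \<omega>))) = 2 * L * ((u - \<beta>) \<bullet> V S \<omega>)"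
        unfolding V_def inner_sum_right sum_distrib_left by (intro sum.cong) (auto simp: g_def)
      also have "\<dots> \<le> 2 * L * (norm (u - \<beta>) * norm (V S \<omega>))"
        using L by (intro mult_left_mono norm_cauchy_schwarz) auto
      also have "\<dots> \<le> 2 * L * (m * norm (V S \<omega>))"
        using L F(3) u by (intro mult_left_mono mult_right_mono) (auto simp: dist_norm norm_minus_commute)
      finally show ?thesis by (simp add: mult.assoc)
    qed
    then show "(MAX u\<in>F. \<Sum>i\<in>I. if i \<in> S then 2 * g u (Z i \<omega>) else - (2 * g u (Z i \<omega>)))
        \<le> 2 * L * m * norm (V S \<omega>)"
      using F by simp
  qed
  also have "\<dots> = 2 * L * m * expectation (\<lambda>\<omega>. \<Sum>S\<in>Pow I. norm (V S \<omega>))"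
    using int_V by (subst Bochner_Integration.integral_sum) (auto simp: sum_distrib_left)
  \<comment> \<open>With the sum over signs inside the expectation, the Rademacher bound applies for
    each fixed \<open>\<omega>\<close>; its factor \<open>2 ^ card I\<close> cancels the one on the
    left.\<close>
  also have "\<dots> \<le> 2 * L * m * expectation (\<lambda>\<omega>. 2 ^ card I * sqrt (Q \<omega>))"
    unfolding V_def Q_def using L m
    by (intro mult_left_mono integral_mono sum_norm_signed_sum_le I)
      (auto simp: V_def[symmetric] Q_def[symmetric] int_V int_sQ)
  also have "\<dots> = 2 ^ card I * (2 * L * m * expectation (\<lambda>\<omega>. sqrt (Q \<omega>)))"
    by simp
  finally have "expectation (\<lambda>\<omega>. MAX u\<in>F. \<Sum>i\<in>I. f u (Z i \<omega>) - expectation (\<lambda>\<omega>. f u (Z i \<omega>)))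
    \<le> 2 * L * m * expectation (\<lambda>\<omega>. sqrt (Q \<omega>))" by simp
  also have "\<dots> \<le> 2 * L * m * sqrt (real (card I) * B)"
  proof (intro mult_left_mono)
    have Q0: "Q \<omega> \<ge> 0" for \<omega> by (simp add: Q_def sum_nonneg)
    have "expectation (\<lambda>\<omega>. sqrt (Q \<omega>)) \<le> sqrt (expectation Q)"
      using expectation_le_sqrt[OF int_sQ] int_Q Q0 by simp
    also have "expectation Q \<le> real (card I) * B"
      unfolding Q_def using int_x B by (auto intro!: sum_bounded_above)
    finally show "expectation (\<lambda>\<omega>. sqrt (Q \<omega>)) \<le> sqrt (real (card I) * B)" by simp
  qed (use L m in auto)
  finally show ?thesis .
qed

text \<open>Continuity in \<open>u\<close> reduces \<open>U\<close> to a countable dense subset. The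
  event is then an increasing union of events over finite sets, which makes it measurable, and
  Markov's inequality with the bound on expected maxima controls each of them.\<close>

lemma (in prob_space) uniform_deviation_tail:
  fixes f :: "'v::euclidean_space \<Rightarrow> 'z \<Rightarrow> real" and Z :: "'i \<Rightarrow> 'a \<Rightarrow> 'z" and x :: "'z \<Rightarrow> 'v"
  assumes indep: "indep_vars (\<lambda>_. N) Z I" and I: "finite I"
    and U: "\<beta> \<in> U" "U \<subseteq> cball \<beta> m"
    and [measurable]: "\<And>u. f u \<in> borel_measurable N" "x \<in> borel_measurable N"
    and f_\<beta>: "\<And>z. z \<in> space N \<Longrightarrow> f \<beta> z = 0"
    and int_x: "\<And>i. i \<in> I \<Longrightarrow> integrable M (\<lambda>\<omega>. (norm (x (Z i \<omega>)))\<^sup>2)"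
    and B: "\<And>i. i \<in> I \<Longrightarrow> expectation (\<lambda>\<omega>. (norm (x (Z i \<omega>)))\<^sup>2) \<le> B"
    and L: "L \<ge> 0"
    and Lip: "\<And>u v z. u \<in> U \<Longrightarrow> v \<in> U \<Longrightarrow> z \<in> space N \<Longrightarrow> \<bar>f u z - f v z\<bar> \<le> L * \<bar>(u - v) \<bullet> x z\<bar>"
    and c: "c > 0"
  defines "A \<equiv> {\<omega> \<in> space M. \<exists>u\<in>U. c < (\<Sum>i\<in>I. f u (Z i \<omega>) - expectation (\<lambda>\<omega>. f u (Z i \<omega>)))}"
  shows "A \<in> events" "prob A \<le> 2 * L * m * sqrt (real (card I) * B) / c"
proof -
  define G where "G u \<omega> = (\<Sum>i\<in>I. f u (Z i \<omega>) - expectation (\<lambda>\<omega>. f u (Z i \<omega>)))" for u \<omega>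
  have Zm [measurable]: "Z i \<in> M \<rightarrow>\<^sub>M N" if "i \<in> I" for i
    using indep that by (auto simp: indep_vars_def)
  have Zs: "Z i \<omega> \<in> space N" if "i \<in> I" "\<omega> \<in> space M" for i \<omega>
    using Zm that measurable_space by metis
  have int_n: "integrable M (\<lambda>\<omega>. norm (x (Z i \<omega>)))" if "i \<in> I" for i
  proof (rule square_integrable_imp_integrable[OF _ int_x[OF that]])
    have "Z i \<in> M \<rightarrow>\<^sub>M N" using Zm that by simp
    then show "(\<lambda>\<omega>. norm (x (Z i \<omega>))) \<in> borel_measurable M" by measurable
  qed
  \<comment> \<open>A Lipschitz bound in \<open>u\<close> with random constant
    \<open>L * norm (x z)\<close>. It yields integrability, by comparison with
    \<open>f \<beta> = 0\<close>, and continuity of both sums and expectations.\<close>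
  have Lip': "\<bar>f u z - f v z\<bar> \<le> L * norm (x z) * norm (u - v)" if "u \<in> U" "v \<in> U" "z \<in> space N" for u v z
  proof -
    have "\<bar>f u z - f v z\<bar> \<le> L * \<bar>(u - v) \<bullet> x z\<bar>" by (rule Lip[OF that])
    also have "\<dots> \<le> L * (norm (u - v) * norm (x z))"
      using L by (intro mult_left_mono Cauchy_Schwarz_ineq2)
    finally show ?thesis by (simp add: algebra_simps)
  qed
  have int_f: "integrable M (\<lambda>\<omega>. f u (Z i \<omega>))" if "i \<in> I" "u \<in> U" for i u
  proof (rule Bochner_Integration.integrable_bound)
    show "integrable M (\<lambda>\<omega>. L * norm (x (Z i \<omega>)) * norm (u - \<beta>))"
      using int_n that by auto
    show "AE \<omega> in M. norm (f u (Z i \<omega>)) \<le> norm (L * norm (x (Z i \<omega>)) * norm (u - \<beta>))"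
      using Lip'[OF that(2) U(1)] f_\<beta> Zs that L by (intro AE_I2) (fastforce simp: abs_mult)
    have "Z i \<in> M \<rightarrow>\<^sub>M N" using Zm that by simp
    then show "(\<lambda>\<omega>. f u (Z i \<omega>)) \<in> borel_measurable M" by measurable
  qed
  have Gm [measurable]: "G u \<in> borel_measurable M" for u
    unfolding G_def by measurable
  have G_cont: "continuous_on U (\<lambda>u. G u \<omega>)" if "\<omega> \<in> space M" for \<omega>
  proof -
    have "continuous_on U (\<lambda>u. f u (Z i \<omega>))" if "i \<in> I" for i
    proof (rule lipschitz_on_continuous_on)
      show "(L * norm (x (Z i \<omega>)))-lipschitz_on U (\<lambda>u. f u (Z i \<omega>))"
        using Lip' L Zs that \<open>\<omega> \<in> space M\<close> by (intro lipschitz_onI) (auto simp: dist_norm)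
    qed
    moreover have "continuous_on U (\<lambda>u. expectation (\<lambda>\<omega>. f u (Z i \<omega>)))" if i: "i \<in> I" for i
    proof (rule lipschitz_on_continuous_on)
      show "(L * expectation (\<lambda>\<omega>. norm (x (Z i \<omega>))))-lipschitz_on U (\<lambda>u. expectation (\<lambda>\<omega>. f u (Z i \<omega>)))"
      proof (rule lipschitz_onI)
        fix u v assume uv: "u \<in> U" "v \<in> U"
        have "dist (expectation (\<lambda>\<omega>. f u (Z i \<omega>))) (expectation (\<lambda>\<omega>. f v (Z i \<omega>)))
          = \<bar>expectation (\<lambda>\<omega>. f u (Z i \<omega>) - f v (Z i \<omega>))\<bar>"
          using int_f i uv by (simp add: dist_norm)
        also have "\<dots> \<le> expectation (\<lambda>\<omega>. L * norm (x (Z i \<omega>)) * norm (u - v))"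
          using int_f i uv int_n Lip'[OF uv] Zs
          by (intro order_trans[OF integral_abs_bound] integral_mono) auto
        finally show "dist (expectation (\<lambda>\<omega>. f u (Z i \<omega>))) (expectation (\<lambda>\<omega>. f v (Z i \<omega>)))
          \<le> L * expectation (\<lambda>\<omega>. norm (x (Z i \<omega>))) * dist u v" by (simp add: dist_norm)
      qed (use L in auto)
    qed
    ultimately show ?thesis unfolding G_def by (intro continuous_intros) auto
  qed
  obtain D where D: "countable D" "D \<subseteq> U" "U \<subseteq> closure D"
    using separable by blast
  have "D \<noteq> {}" using D U by auto
  define d where "d = from_nat_into D"
  have d: "d k \<in> U" for k using from_nat_into[OF \<open>D \<noteq> {}\<close>] D by (auto simp: d_def)
  define A' where "A' n = {\<omega> \<in> space M. \<exists>k\<le>n. c < G (d k) \<omega>}" for n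
  have A'_m [measurable]: "A' n \<in> events" for n
    unfolding A'_def by measurable
  \<comment> \<open>The condition \<open>c < G u \<omega>\<close> is open in \<open>u\<close>
    relative to \<open>U\<close>, so some point of \<open>D\<close> near \<open>u\<close> satisfies
    it too.\<close>
  have "A = (\<Union>n. A' n)"
  proof (intro equalityI subsetI)
    fix \<omega> assume "\<omega> \<in> A"
    then obtain u where u: "\<omega> \<in> space M" "u \<in> U" "c < G u \<omega>" by (auto simp: A_def G_def)
    have "openin (top_of_set U) (U \<inter> (\<lambda>u. G u \<omega>) -` {c<..})"
      using G_cont[OF u(1)] by (rule continuous_openin_preimage_gen) auto
    then obtain T where T: "open T" "U \<inter> (\<lambda>u. G u \<omega>) -` {c<..} = U \<inter> T"
      by (auto simp: openin_open)
    then have "u \<in> T" using u by auto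
    moreover have "u \<in> closure D" using u D by auto
    ultimately obtain v where v: "v \<in> D" "v \<in> T"
      using T(1) by (meson closure_iff_nhds_not_empty disjoint_iff order_refl)
    then obtain k where "v = d k"
      using D(1) from_nat_into_surj by (metis d_def)
    then show "\<omega> \<in> (\<Union>n. A' n)" using v T D u by (auto simp: A'_def intro!: exI[of _ k])
  next
    fix \<omega> assume "\<omega> \<in> (\<Union>n. A' n)"
    then show "\<omega> \<in> A" using d by (auto simp: A'_def A_def G_def)
  qed
  then show "A \<in> events" by auto
  have "prob (A' n) \<le> 2 * L * m * sqrt (real (card I) * B) / c" for n
  proof -
    \<comment> \<open>Including \<open>\<beta>\<close>, where \<open>G\<close> vanishes, makes the
      maximum nonnegative, as Markov's inequality requires.\<close>
    define F where "F = insert \<beta> (d ` {..n})"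
    have F: "finite F" "F \<noteq> {}" "F \<subseteq> U" "\<beta> \<in> F" using d U by (auto simp: F_def)
    have int_G: "integrable M (G u)" if "u \<in> F" for u
      unfolding G_def using that F int_f by auto
    have G_le: "G u \<omega> \<le> (MAX u\<in>F. G u \<omega>)" if "u \<in> F" for u \<omega>
      using that F by (intro Max_ge) auto
    have G\<beta>: "G \<beta> \<omega> = 0" if "\<omega> \<in> space M" for \<omega>
    proof -
      have "expectation (\<lambda>\<omega>. f \<beta> (Z i \<omega>)) = expectation (\<lambda>\<omega>. 0)" if "i \<in> I" for i
        using that f_\<beta> Zs by (intro Bochner_Integration.integral_cong) auto
      then show ?thesis using that f_\<beta> Zs by (auto simp: G_def)
    qed
    have int_M: "integrable M (\<lambda>\<omega>. MAX u\<in>F. G u \<omega>)"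
      by (intro integrable_MAX F int_G)
    have [measurable]: "(\<lambda>\<omega>. MAX u\<in>F. G u \<omega>) \<in> borel_measurable M"
      using int_M by simp
    have "prob (A' n) \<le> prob {\<omega> \<in> space M. (MAX u\<in>F. G u \<omega>) \<ge> c}"
    proof (intro finite_measure_mono subsetI)
      fix \<omega> assume "\<omega> \<in> A' n"
      then obtain k where k: "\<omega> \<in> space M" "k \<le> n" "c < G (d k) \<omega>" by (auto simp: A'_def)
      with G_le[of "d k" \<omega>] show "\<omega> \<in> {\<omega> \<in> space M. (MAX u\<in>F. G u \<omega>) \<ge> c}"
        by (auto simp: F_def)
    qed measurable
    also have "\<dots> \<le> expectation (\<lambda>\<omega>. MAX u\<in>F. G u \<omega>) / c"
      using G_le[OF F(4)] G\<beta>
      by (intro integral_Markov_inequality_measure[where A = "{}"] int_M c AE_I2) (auto, metis)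
    also have "\<dots> \<le> 2 * L * m * sqrt (real (card I) * B) / c"
      unfolding G_def using F U c int_f subsetD[OF F(3)]
      by (intro divide_right_mono expectation_MAX_centered_le[OF indep I, where x = x and \<beta> = \<beta>] int_x B L Lip) auto
    finally show ?thesis .
  qed
  \<comment> \<open>The bound is uniform in \<open>n\<close> and so passes to the increasing
    union.\<close>
  moreover have "(\<lambda>n. prob (A' n)) \<longlonglongrightarrow> prob A"
    unfolding \<open>A = (\<Union>n. A' n)\<close>
    by (intro finite_Lim_measure_incseq) (auto simp: incseq_def A'_def intro: order_trans)
  ultimately show "prob A \<le> 2 * L * m * sqrt (real (card I) * B) / c"
    by (intro LIMSEQ_le_const2) auto
qed

section \<open>The loss and the empirical risk\<close>

text \<open>The response has only two values: for each of them the loss is continuous in the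
  predictor, and the two pieces are glued along \<open>snd\<close>.\<close>

lemma loss_measurable:
  fixes b :: "real ^ 'p" and \<rho> :: "real \<Rightarrow> nat \<Rightarrow> real"
  assumes "\<And>y. y \<in> {0, 1} \<Longrightarrow> continuous_on UNIV (\<lambda>t. \<rho> t y)"
  shows "(\<lambda>z. \<rho> (b \<bullet> fst z) (snd z)) \<in> borel_measurable obs_space"
proof (rule measurable_compose_countable'[where f = "\<lambda>y z. \<rho> (b \<bullet> fst z) y" and g = snd and I = "{0, 1}"])
  fix y :: nat assume "y \<in> {0, 1}"
  then have [measurable]: "(\<lambda>t. \<rho> t y) \<in> borel_measurable borel"
    using assms by (intro borel_measurable_continuous_onI)
  show "(\<lambda>z. \<rho> (b \<bullet> fst z) y) \<in> borel_measurable obs_space" by measurable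
qed auto

text \<open>The empirical risk averages convex functions of linear forms in the parameter.\<close>

lemma emp_risk_segment:
  fixes b \<beta> :: "real ^ 'p"
  assumes "\<And>y. y \<in> {0, 1} \<Longrightarrow> convex_on UNIV (\<lambda>t. \<rho> t y)"
    and "\<And>i. i \<in> {1..n} \<Longrightarrow> y i \<in> {0, 1}" and "0 \<le> t" "t \<le> 1"
  shows "emp_risk n \<rho> x y (\<beta> + t *\<^sub>R (b - \<beta>)) \<le> (1 - t) * emp_risk n \<rho> x y \<beta> + t * emp_risk n \<rho> x y b"
proof -
  have "\<rho> ((\<beta> + t *\<^sub>R (b - \<beta>)) \<bullet> x i) (y i) \<le> (1 - t) * \<rho> (\<beta> \<bullet> x i) (y i) + t * \<rho> (b \<bullet> x i) (y i)"
    if "i \<in> {1..n}" for i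
  proof -
    have "(\<beta> + t *\<^sub>R (b - \<beta>)) \<bullet> x i = (1 - t) *\<^sub>R (\<beta> \<bullet> x i) + t *\<^sub>R (b \<bullet> x i)"
      by (simp add: algebra_simps)
    then show ?thesis
      using convex_onD[OF assms(1)[OF assms(2)[OF that]] assms(3,4)] by simp
  qed
  then have "(\<Sum>i = 1..n. \<rho> ((\<beta> + t *\<^sub>R (b - \<beta>)) \<bullet> x i) (y i))
      \<le> (\<Sum>i = 1..n. (1 - t) * \<rho> (\<beta> \<bullet> x i) (y i) + t * \<rho> (b \<bullet> x i) (y i))"
    by (rule sum_mono)
  also have "\<dots> = (1 - t) * (\<Sum>i = 1..n. \<rho> (\<beta> \<bullet> x i) (y i)) + t * (\<Sum>i = 1..n. \<rho> (b \<bullet> x i) (y i))"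
    by (simp only: sum.distrib sum_distrib_left)
  finally show ?thesis
    unfolding emp_risk_def by (cases "n = 0") (simp_all add: field_simps)
qed

text \<open>A vector missing a coordinate of \<open>supp \<beta>\<close> lies at distance at least \<open>m\<close> from \<open>\<beta>\<close>, so by
  convexity it can be pulled back along the segment to the sphere of radius \<open>m\<close>.\<close>

lemma emp_risk_sphere:
  fixes b \<beta> :: "real ^ 'p"
  assumes convex: "\<And>y. y \<in> {0, 1} \<Longrightarrow> convex_on UNIV (\<lambda>t. \<rho> t y)"
    and y: "\<And>i. i \<in> {1..n} \<Longrightarrow> y i \<in> {0, 1}"
    and b: "supp b \<subset> supp \<beta>" and m: "m > 0" "\<And>j. j \<in> supp \<beta> \<Longrightarrow> m \<le> \<bar>\<beta> $ j\<bar>"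
    and le: "emp_risk n \<rho> x y b - emp_risk n \<rho> x y \<beta> \<le> \<delta>" and "\<delta> \<ge> 0"
  obtains u where "supp u \<subseteq> supp \<beta>" "norm (u - \<beta>) = m"
    "emp_risk n \<rho> x y u - emp_risk n \<rho> x y \<beta> \<le> \<delta>"
proof -
  obtain j where j: "j \<in> supp \<beta>" "j \<notin> supp b" using b by auto
  have "m \<le> \<bar>(b - \<beta>) $ j\<bar>" using m(2)[OF j(1)] j(2) by (simp add: supp_def)
  then have dist: "m \<le> norm (b - \<beta>)" using component_le_norm_cart order_trans by blast
  define t where "t = m / norm (b - \<beta>)"
  have t: "0 \<le> t" "t \<le> 1" using m(1) dist by (simp_all add: t_def divide_le_eq)
  show thesis
  proof (rule that)
    show "supp (\<beta> + t *\<^sub>R (b - \<beta>)) \<subseteq> supp \<beta>" using b by (auto simp: supp_def)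
    show "norm (\<beta> + t *\<^sub>R (b - \<beta>) - \<beta>) = m" using m(1) dist by (cases "b = \<beta>") (auto simp: t_def)
    have "emp_risk n \<rho> x y (\<beta> + t *\<^sub>R (b - \<beta>)) - emp_risk n \<rho> x y \<beta>
        \<le> t * (emp_risk n \<rho> x y b - emp_risk n \<rho> x y \<beta>)"
      using emp_risk_segment[OF convex y t, where x = x and \<beta> = \<beta> and b = b] by (simp add: algebra_simps)
    also have "\<dots> \<le> t * \<delta>" using le t by (intro mult_left_mono)
    also have "\<dots> \<le> 1 * \<delta>" using t \<open>\<delta> \<ge> 0\<close> by (intro mult_right_mono)
    finally show "emp_risk n \<rho> x y (\<beta> + t *\<^sub>R (b - \<beta>)) - emp_risk n \<rho> x y \<beta> \<le> \<delta>" by simp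
  qed
qed

text \<open>A finite bound excludes the empty set, whose infimum is \<open>\<infinity>\<close>, and
  over a nonempty finite set the infimum is attained. This extracts a competing model from the
  event.\<close>

lemma INF_ereal_le_finite:
  assumes "finite W" "(INF w\<in>W. ereal (f w)) \<le> ereal c"
  obtains w where "w \<in> W" "f w \<le> c"
proof -
  have "W \<noteq> {}" using assms(2) by (auto simp: top_ereal_def)
  then have "(INF w\<in>W. ereal (f w)) \<in> (\<lambda>w. ereal (f w)) ` W"
    using Min_in[of "(\<lambda>w. ereal (f w)) ` W"] assms(1) by (simp add: Min_Inf)
  then show thesis using assms(2) that by auto
qed

theorem theorem3:
  fixes M :: "'a measure"
    and X :: "'a \<Rightarrow> real ^ 'p" and Y :: "'a \<Rightarrow> nat"
    and Xs :: "nat \<Rightarrow> 'a \<Rightarrow> real ^ 'p" and Ys :: "nat \<Rightarrow> 'a \<Rightarrow> nat"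
    and n k :: nat
    and \<rho> :: "real \<Rightarrow> nat \<Rightarrow> real" and L a \<epsilon> \<theta> :: real
    and \<sigma> :: "'p \<Rightarrow> real"
    and \<beta> :: "real ^ 'p" and \<beta>hat :: "'a \<Rightarrow> 'p set \<Rightarrow> real ^ 'p"
    and \<M> :: "'a \<Rightarrow> 'p set set"
  assumes "prob_space M"
    and "n \<ge> 1" and "k \<ge> 1" and "a > 0"
    and XY: "(\<lambda>\<omega>. (X \<omega>, Y \<omega>)) \<in> M \<rightarrow>\<^sub>M obs_space"
    and indep: "prob_space.indep_vars M (\<lambda>_. obs_space) (\<lambda>i \<omega>. (Xs i \<omega>, Ys i \<omega>)) {1..n}"
    and copies: "\<And>i. i \<in> {1..n} \<Longrightarrow>
      distr M obs_space (\<lambda>\<omega>. (Xs i \<omega>, Ys i \<omega>)) = distr M obs_space (\<lambda>\<omega>. (X \<omega>, Y \<omega>))"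
    and nondegenerate: "\<And>v c. v \<noteq> 0 \<Longrightarrow> \<not> (AE \<omega> in M. v \<bullet> X \<omega> = c)"
    and \<beta>_min: "is_arg_min (risk M \<rho> X Y) (\<lambda>_. True) \<beta>"
    and \<beta>_unique: "\<And>b. is_arg_min (risk M \<rho> X Y) (\<lambda>_. True) b \<Longrightarrow> b = \<beta>"
    and \<M>_measurable: "\<M> \<in> M \<rightarrow>\<^sub>M count_space UNIV"
    and \<M>_models: "AE \<omega> in M. supp \<beta> \<in> \<M> \<omega> \<and> (\<forall>w\<in>\<M> \<omega>. card w \<le> k)"
    and \<beta>hat_measurable: "\<And>w. (\<lambda>\<omega>. \<beta>hat \<omega> w) \<in> borel_measurable M"
    and \<beta>hat_min: "AE \<omega> in M. \<forall>w\<in>\<M> \<omega>.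
      is_arg_min (emp_risk n \<rho> (\<lambda>i. Xs i \<omega>) (\<lambda>i. Ys i \<omega>)) (\<lambda>b. supp b \<subseteq> w) (\<beta>hat \<omega> w)"
    and \<rho>_convex: "\<And>y. y \<in> {0, 1} \<Longrightarrow> convex_on UNIV (\<lambda>t. \<rho> t y)"
    and "L > 0" and \<rho>_Lipschitz: "\<And>y. y \<in> {0, 1} \<Longrightarrow> L-lipschitz_on UNIV (\<lambda>t. \<rho> t y)"
    and "\<And>j. \<sigma> j \<ge> 0"
    and subg: "\<And>j. prob_space.subgaussian M (\<lambda>\<omega>. X \<omega> $ j) ((\<sigma> j)\<^sup>2)"
    and "\<epsilon> > 0" and "\<theta> > 0"
    and margin: "\<And>b. supp b \<subseteq> supp \<beta> \<Longrightarrow> norm (b - \<beta>) \<le> \<epsilon> \<Longrightarrow>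
      risk M \<rho> X Y b - risk M \<rho> X Y \<beta> \<ge> \<theta> * (norm (b - \<beta>))\<^sup>2"
    and penalty: "ereal (8 * a * real (card (supp \<beta>)))
      \<le> ereal (\<theta> * real n) * min (ereal (\<epsilon>\<^sup>2)) ((beta_min \<beta>)\<^sup>2)"
  shows "ereal (measure M {\<omega> \<in> space M.
        (INF w\<in>{w \<in> \<M> \<omega>. w \<subset> supp \<beta>}.
           ereal (GIC n a \<rho> (\<lambda>i. Xs i \<omega>) (\<lambda>i. Ys i \<omega>) (\<beta>hat \<omega>) w))
        \<le> ereal (GIC n a \<rho> (\<lambda>i. Xs i \<omega>) (\<lambda>i. Ys i \<omega>) (\<beta>hat \<omega>) (supp \<beta>))})
    \<le> ereal (32 * L * Max (range \<sigma>) * sqrt (real (card (supp \<beta>))))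
        / (ereal (\<theta> * sqrt (real n)) * min (ereal \<epsilon>) (beta_min \<beta>))"
    (is "ereal (measure M ?E) \<le> ?bound")
proof (cases "supp \<beta> = {}")
  \<comment> \<open>No model lies strictly inside the empty support, so the infimum is
    \<open>\<infinity>\<close> and the event is empty; the numerator of the bound is 0 as
    well.\<close>
  case True
  then show ?thesis by (simp add: top_ereal_def divide_ereal_def flip: zero_ereal_def)
next
  case False
  interpret prob_space M by fact
  let ?Rn = "\<lambda>\<omega>. emp_risk n \<rho> (\<lambda>i. Xs i \<omega>) (\<lambda>i. Ys i \<omega>)"
  let ?R = "risk M \<rho> X Y"
  define s where "s = supp \<beta>"
  \<comment> \<open>The real number behind \<open>beta_min \<beta>\<close>, which is finite because
    the support is nonempty.\<close>
  define \<mu> where "\<mu> = Min ((\<lambda>j. \<bar>\<beta> $ j\<bar>) ` s)"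
  define m where "m = min \<epsilon> \<mu>"
  define \<Sigma> where "\<Sigma> = Max (range \<sigma>)"
  have s: "s \<noteq> {}" using False by (simp add: s_def)
  have \<mu>_le: "\<mu> \<le> \<bar>\<beta> $ j\<bar>" if "j \<in> s" for j
    unfolding \<mu>_def using that by auto
  have "\<mu> \<in> (\<lambda>j. \<bar>\<beta> $ j\<bar>) ` s" unfolding \<mu>_def using s by (intro Min_in) auto
  then have \<mu>: "\<mu> > 0" by (auto simp: s_def supp_def)
  have "beta_min \<beta> = Min ((\<lambda>j. ereal \<bar>\<beta> $ j\<bar>) ` s)"
    using s by (simp add: beta_min_def s_def Min_Inf)
  also have "\<dots> = ereal \<mu>"
    unfolding \<mu>_def using s by (subst mono_Min_commute[of ereal]) (auto simp: mono_def image_image)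
  finally have beta_min: "beta_min \<beta> = ereal \<mu>" .
  have m: "m > 0" "m \<le> \<epsilon>" "\<And>j. j \<in> s \<Longrightarrow> m \<le> \<bar>\<beta> $ j\<bar>"
    using \<mu> \<mu>_le \<open>\<epsilon> > 0\<close> by (auto simp: m_def min_le_iff_disj)
  \<comment> \<open>Squaring preserves the order of positive numbers, so the penalty condition
    becomes a bound by \<open>m^2\<close>.\<close>
  have "min (\<epsilon>\<^sup>2) (\<mu>\<^sup>2) = m\<^sup>2"
    unfolding m_def using \<mu> \<open>\<epsilon> > 0\<close> by (auto simp: min_def power_mono_iff)
  then have "min (ereal (\<epsilon>\<^sup>2)) ((ereal \<mu>)\<^sup>2) = ereal (m\<^sup>2)" by (simp flip: ereal_min)
  then have pen: "8 * a * card s \<le> \<theta> * n * m\<^sup>2"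
    using penalty by (simp add: beta_min s_def[symmetric])
  have \<sigma>_le: "\<sigma> j \<le> \<Sigma>" for j unfolding \<Sigma>_def by simp
  have \<Sigma>: "\<Sigma> \<ge> 0" using \<sigma>_le order_trans[OF \<open>\<And>j. \<sigma> j \<ge> 0\<close>] by blast

  \<comment> \<open>The centered process and the common law of the observations\<close>
  define Z where "Z = (\<lambda>i \<omega>. (Xs i \<omega>, Ys i \<omega>))"
  \<comment> \<open>Differences of vectors supported in \<open>s\<close> see only these coordinates
    of the predictor. Projecting first gives the second moment bound
    \<open>card s * \<Sigma>^2\<close>, with no dependence on the full dimension.\<close>
  define proj where "proj v = (\<chi> j. if j \<in> s then v $ j else 0)" for v :: "real ^ 'p"
  \<comment> \<open>Loss at \<open>\<beta>\<close> minus loss at \<open>u\<close>: a large centered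
    sum means that the empirical excess risk of \<open>u\<close> falls short of the true
    one.\<close>
  define f where "f u z = \<rho> (\<beta> \<bullet> fst z) (snd z) - \<rho> (u \<bullet> fst z) (snd z)"
    for u and z :: "(real ^ 'p) \<times> nat"
  define U where "U = {u. supp u \<subseteq> s \<and> norm (u - \<beta>) \<le> m}"
  \<comment> \<open>Half of the margin \<open>\<theta> * m^2\<close> at radius \<open>m\<close>,
    scaled to sums over \<open>n\<close> observations.\<close>
  define c where "c = n * \<theta> * m\<^sup>2 / 2"
  define A where "A = {\<omega> \<in> space M. \<exists>u\<in>U. c < (\<Sum>i\<in>{1..n}. f u (Z i \<omega>) - expectation (\<lambda>\<omega>. f u (Z i \<omega>)))}"
  have c: "c > 0" using m \<open>\<theta> > 0\<close> \<open>n \<ge> 1\<close> by (simp add: c_def)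
  have Z_m: "Z i \<in> M \<rightarrow>\<^sub>M obs_space" if "i \<in> {1..n}" for i
    using indep that by (auto simp: Z_def indep_vars_def)
  have X_m [measurable]: "X \<in> borel_measurable M" using measurable_compose[OF XY measurable_fst] by simp
  have Y01: "Y \<omega> \<in> {0, 1}" if "\<omega> \<in> space M" for \<omega>
    using measurable_space[OF XY that] by (simp add: space_pair_measure)
  have Ys01: "Ys i \<omega> \<in> {0, 1}" if "\<omega> \<in> space M" "i \<in> {1..n}" for i \<omega>
    using measurable_space[OF Z_m[OF that(2)] that(1)] by (simp add: space_pair_measure Z_def)
  have loss_m [measurable]: "(\<lambda>z. \<rho> (b \<bullet> fst z) (snd z)) \<in> borel_measurable obs_space" for b :: "real ^ 'p"
    using \<rho>_Lipschitz by (intro loss_measurable lipschitz_on_continuous_on)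
  have transfer_expectation: "expectation (\<lambda>\<omega>. h (Z i \<omega>)) = expectation (\<lambda>\<omega>. h (X \<omega>, Y \<omega>))"
    and transfer_integrable: "integrable M (\<lambda>\<omega>. h (Z i \<omega>)) \<longleftrightarrow> integrable M (\<lambda>\<omega>. h (X \<omega>, Y \<omega>))"
    if "i \<in> {1..n}" and [measurable]: "h \<in> borel_measurable obs_space"
    for i and h :: "(real ^ 'p) \<times> nat \<Rightarrow> real"
    using integral_distr[OF Z_m[OF that(1)] that(2)] integral_distr[OF XY that(2)]
      integrable_distr_eq[OF Z_m[OF that(1)] that(2)] integrable_distr_eq[OF XY that(2)]
      copies[OF that(1)]
    by (simp_all add: Z_def)

  \<comment> \<open>Moments and integrability\<close>
  have X2: "integrable M (\<lambda>\<omega>. (X \<omega> $ j)\<^sup>2)" "expectation (\<lambda>\<omega>. (X \<omega> $ j)\<^sup>2) \<le> \<Sigma>\<^sup>2" for j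
  proof -
    note subgaussian_second_moment[OF subg[of j]]
    then show "integrable M (\<lambda>\<omega>. (X \<omega> $ j)\<^sup>2)" "expectation (\<lambda>\<omega>. (X \<omega> $ j)\<^sup>2) \<le> \<Sigma>\<^sup>2"
      using power_mono[OF \<sigma>_le \<open>\<And>j. \<sigma> j \<ge> 0\<close>, of j 2] by auto
  qed
  have X1: "integrable M (\<lambda>\<omega>. X \<omega> $ j)" for j
    by (rule square_integrable_imp_integrable[OF _ X2(1)]) (use subg[of j] in \<open>simp add: subgaussian_def\<close>)
  have int_inner: "integrable M (\<lambda>\<omega>. b \<bullet> X \<omega>)" for b
    unfolding inner_vec_def using X1 by simp
  have int_loss: "integrable M (\<lambda>\<omega>. \<rho> (b \<bullet> X \<omega>) (Y \<omega>))" for b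
  proof (rule Bochner_Integration.integrable_bound)
    show "integrable M (\<lambda>\<omega>. \<bar>\<rho> 0 0\<bar> + \<bar>\<rho> 0 1\<bar> + L * \<bar>b \<bullet> X \<omega>\<bar>)" using int_inner by simp
    show "(\<lambda>\<omega>. \<rho> (b \<bullet> X \<omega>) (Y \<omega>)) \<in> borel_measurable M"
      using measurable_compose[OF XY loss_m] by simp
    show "AE \<omega> in M. norm (\<rho> (b \<bullet> X \<omega>) (Y \<omega>)) \<le> norm (\<bar>\<rho> 0 0\<bar> + \<bar>\<rho> 0 1\<bar> + L * \<bar>b \<bullet> X \<omega>\<bar>)"
    proof (rule AE_I2)
      fix \<omega> assume "\<omega> \<in> space M"
      note y = Y01[OF this]
      have "\<bar>\<rho> (b \<bullet> X \<omega>) (Y \<omega>) - \<rho> 0 (Y \<omega>)\<bar> \<le> L * \<bar>b \<bullet> X \<omega>\<bar>"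
        using lipschitz_onD[OF \<rho>_Lipschitz[OF y], of "b \<bullet> X \<omega>" 0] by (simp add: dist_real_def)
      moreover have "\<bar>\<rho> 0 (Y \<omega>)\<bar> \<le> \<bar>\<rho> 0 0\<bar> + \<bar>\<rho> 0 1\<bar>" using y by auto
      ultimately show "norm (\<rho> (b \<bullet> X \<omega>) (Y \<omega>)) \<le> norm (\<bar>\<rho> 0 0\<bar> + \<bar>\<rho> 0 1\<bar> + L * \<bar>b \<bullet> X \<omega>\<bar>)"
        using \<open>L > 0\<close> by simp
    qed
  qed

  have proj_norm: "(norm (proj v))\<^sup>2 = (\<Sum>j\<in>s. (v $ j)\<^sup>2)" for v
    unfolding power2_norm_eq_inner inner_vec_def proj_def
    by (simp add: power2_eq_square if_distrib cong: if_cong sum.cong) (simp add: sum.If_cases)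
  have proj_m [measurable]: "(\<lambda>z. proj (fst z)) \<in> borel_measurable obs_space"
  proof -
    have "continuous_on UNIV proj"
      unfolding proj_def
    proof (rule continuous_on_vec_lambda)
      show "continuous_on UNIV (\<lambda>v :: real ^ 'p. if j \<in> s then v $ j else 0)" for j
        by (cases "j \<in> s") (auto intro!: continuous_intros)
    qed
    then have [measurable]: "proj \<in> borel_measurable borel" by (rule borel_measurable_continuous_onI)
    show ?thesis by measurable
  qed
  have proj_norm_m: "(\<lambda>z. (norm (proj (fst z)))\<^sup>2) \<in> borel_measurable obs_space"
    using proj_m by measurable
  have int_proj: "integrable M (\<lambda>\<omega>. (norm (proj (fst (Z i \<omega>))))\<^sup>2)" if i: "i \<in> {1..n}" for i
    using X2(1) transfer_integrable[OF i proj_norm_m] by (simp add: proj_norm)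
  have E_proj: "expectation (\<lambda>\<omega>. (norm (proj (fst (Z i \<omega>))))\<^sup>2) \<le> card s * \<Sigma>\<^sup>2" if i: "i \<in> {1..n}" for i
  proof -
    have "expectation (\<lambda>\<omega>. (norm (proj (fst (Z i \<omega>))))\<^sup>2) = expectation (\<lambda>\<omega>. (norm (proj (X \<omega>)))\<^sup>2)"
      using transfer_expectation[OF i proj_norm_m] by simp
    also have "\<dots> = (\<Sum>j\<in>s. expectation (\<lambda>\<omega>. (X \<omega> $ j)\<^sup>2))"
      unfolding proj_norm using X2(1) by simp
    also have "\<dots> \<le> card s * \<Sigma>\<^sup>2" using X2(2) by (intro sum_bounded_above)
    finally show ?thesis .
  qed

  \<comment> \<open>Tail bound for the deviation event\<close>
  have indep_Z: "indep_vars (\<lambda>_. obs_space) Z {1..n}" using indep unfolding Z_def .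
  have U: "\<beta> \<in> U" "U \<subseteq> cball \<beta> m"
    using m by (auto simp: U_def s_def dist_norm norm_minus_commute)
  have f_m: "f u \<in> borel_measurable obs_space" for u
    unfolding f_def by measurable
  have f_\<beta>: "f \<beta> z = 0" for z by (simp add: f_def)
  have f_Lipschitz: "\<bar>f u z - f v z\<bar> \<le> L * \<bar>(u - v) \<bullet> proj (fst z)\<bar>"
    if "u \<in> U" "v \<in> U" "z \<in> space obs_space" for u v z
  proof -
    have "snd z \<in> {0, 1}" using that by (auto simp: space_pair_measure)
    then have "\<bar>\<rho> (v \<bullet> fst z) (snd z) - \<rho> (u \<bullet> fst z) (snd z)\<bar> \<le> L * \<bar>v \<bullet> fst z - u \<bullet> fst z\<bar>"
      using lipschitz_onD[OF \<rho>_Lipschitz] by (simp add: dist_real_def)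
    \<comment> \<open>Both vectors vanish outside \<open>s\<close>, so projecting the predictor does
      not change its inner product with \<open>u - v\<close>.\<close>
    moreover have "u $ j = 0" "v $ j = 0" if "j \<notin> s" for j
      using that \<open>u \<in> U\<close> \<open>v \<in> U\<close> by (auto simp: U_def supp_def)
    then have "(u - v) \<bullet> proj (fst z) = u \<bullet> fst z - v \<bullet> fst z"
      unfolding inner_diff_left[symmetric] unfolding inner_vec_def proj_def
      by (intro sum.cong) auto
    ultimately show ?thesis by (simp add: f_def abs_minus_commute)
  qed
  note tail = uniform_deviation_tail[OF indep_Z finite_atLeastAtMost U f_m proj_m f_\<beta> int_proj E_proj
      less_imp_le[OF \<open>L > 0\<close>] f_Lipschitz c, folded A_def]
  have "2 * L * m * sqrt (real (card {1..n}) * (real (card s) * \<Sigma>\<^sup>2)) / c = 4 * L * \<Sigma> * sqrt (card s) / (\<theta> * sqrt n * m)"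
  proof -
    have "real n = sqrt n * sqrt n" by simp
    then show ?thesis
      unfolding c_def using m \<open>n \<ge> 1\<close> \<open>\<theta> > 0\<close> \<Sigma>
      by (simp add: real_sqrt_mult power2_eq_square divide_simps)
  qed
  \<comment> \<open>The tail bound comes with the constant 4, relaxed here to 32.\<close>
  also have "\<dots> \<le> 32 * L * \<Sigma> * sqrt (card s) / (\<theta> * sqrt n * m)"
    using m \<open>\<theta> > 0\<close> \<open>L > 0\<close> \<Sigma> by (intro divide_right_mono mult_right_mono) auto
  finally have prob_A: "prob A \<le> 32 * L * \<Sigma> * sqrt (card s) / (\<theta> * sqrt n * m)"
    using tail(2) by simp

  \<comment> \<open>Almost sure inclusion of the selection event in \<open>A\<close>\<close>
  have "AE \<omega> in M. \<omega> \<in> ?E \<longrightarrow> \<omega> \<in> A"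
    using \<M>_models \<beta>hat_min AE_space
  proof eventually_elim
    case (elim \<omega>)
    show ?case
    proof
      assume "\<omega> \<in> ?E"
      then obtain w where w: "w \<in> \<M> \<omega>" "w \<subset> s"
        "GIC n a \<rho> (\<lambda>i. Xs i \<omega>) (\<lambda>i. Ys i \<omega>) (\<beta>hat \<omega>) w \<le> GIC n a \<rho> (\<lambda>i. Xs i \<omega>) (\<lambda>i. Ys i \<omega>) (\<beta>hat \<omega>) s"
        unfolding s_def by (auto elim!: INF_ereal_le_finite[rotated])
      \<comment> \<open>\<open>\<beta>\<close> is itself a candidate in the model \<open>s\<close>,
        so it may replace the unknown minimizer in the comparison of criteria.\<close>
      have "?Rn \<omega> (\<beta>hat \<omega> s) \<le> ?Rn \<omega> \<beta>"
        using elim by (auto simp: is_arg_min_linorder s_def)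
      then have "n * ?Rn \<omega> (\<beta>hat \<omega> s) \<le> n * ?Rn \<omega> \<beta>" by (intro mult_left_mono) auto
      moreover have "0 \<le> a * card w" using \<open>a > 0\<close> by simp
      ultimately have "n * (?Rn \<omega> (\<beta>hat \<omega> w) - ?Rn \<omega> \<beta>) \<le> a * card s"
        using w(3) by (simp add: GIC_def algebra_simps)
      also have "\<dots> \<le> n * (\<theta> * m\<^sup>2 / 8)" using pen by (simp add: algebra_simps)
      finally have le: "?Rn \<omega> (\<beta>hat \<omega> w) - ?Rn \<omega> \<beta> \<le> \<theta> * m\<^sup>2 / 8"
        using \<open>n \<ge> 1\<close> by simp
      have supp_w: "supp (\<beta>hat \<omega> w) \<subset> supp \<beta>"
        using elim w by (auto simp: is_arg_min_def s_def)
      obtain u where u: "supp u \<subseteq> supp \<beta>" "norm (u - \<beta>) = m" "?Rn \<omega> u - ?Rn \<omega> \<beta> \<le> \<theta> * m\<^sup>2 / 8"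
        using emp_risk_sphere[OF \<rho>_convex Ys01[OF elim(3)] supp_w m(1) m(3) le] \<open>\<theta> > 0\<close>
        unfolding s_def by auto
      have "(\<Sum>i\<in>{1..n}. f u (Z i \<omega>) - expectation (\<lambda>\<omega>. f u (Z i \<omega>)))
          = (\<Sum>i\<in>{1..n}. f u (Z i \<omega>)) - n * (?R \<beta> - ?R u)"
      proof -
        have "expectation (\<lambda>\<omega>. f u (Z i \<omega>)) = ?R \<beta> - ?R u" if "i \<in> {1..n}" for i
        proof -
          from transfer_expectation[OF that f_m] show ?thesis
            using int_loss by (simp add: f_def risk_def)
        qed
        then show ?thesis by (simp add: sum_subtractf)
      qed
      also have "(\<Sum>i\<in>{1..n}. f u (Z i \<omega>)) = n * (?Rn \<omega> \<beta> - ?Rn \<omega> u)"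
        using \<open>n \<ge> 1\<close> by (simp add: f_def Z_def emp_risk_def sum_subtractf algebra_simps)
      also have "\<dots> - n * (?R \<beta> - ?R u) = n * ((?R u - ?R \<beta>) - (?Rn \<omega> u - ?Rn \<omega> \<beta>))"
        by (simp add: algebra_simps)
      finally have eq: "(\<Sum>i\<in>{1..n}. f u (Z i \<omega>) - expectation (\<lambda>\<omega>. f u (Z i \<omega>)))
          = n * ((?R u - ?R \<beta>) - (?Rn \<omega> u - ?Rn \<omega> \<beta>))" .
      have "\<theta> * m\<^sup>2 > 0" using m \<open>\<theta> > 0\<close> by simp
      \<comment> \<open>Since \<open>norm (u - \<beta>) = m \<le> \<epsilon>\<close>, the margin
        gives a true excess of at least \<open>\<theta> * m^2\<close>, while the empirical one is at
        most an eighth of this. The remaining seven eighths exceed one half strictly.\<close>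
      then have "\<theta> * m\<^sup>2 / 2 < (?R u - ?R \<beta>) - (?Rn \<omega> u - ?Rn \<omega> \<beta>)"
        using margin[OF u(1)] u m by simp
      then have "n * (\<theta> * m\<^sup>2 / 2) < n * ((?R u - ?R \<beta>) - (?Rn \<omega> u - ?Rn \<omega> \<beta>))"
        using \<open>n \<ge> 1\<close> by (intro mult_strict_left_mono) auto
      then have "c < (\<Sum>i\<in>{1..n}. f u (Z i \<omega>) - expectation (\<lambda>\<omega>. f u (Z i \<omega>)))"
        unfolding eq by (simp add: c_def mult.assoc)
      then show "\<omega> \<in> A" using u elim by (auto simp: A_def U_def s_def)
    qed
  qed
  then have "prob ?E \<le> prob A"
    by (rule finite_measure_mono_AE) (rule tail(1))
  with prob_A have "prob ?E \<le> 32 * L * \<Sigma> * sqrt (card s) / (\<theta> * sqrt n * m)" by linarith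
  then have "ereal (prob ?E) \<le> ereal (32 * L * \<Sigma> * sqrt (card s)) / (ereal (\<theta> * sqrt n) * ereal m)"
    using m \<open>\<theta> > 0\<close> \<open>n \<ge> 1\<close> by simp
  then show ?thesis
    by (simp add: beta_min m_def s_def \<Sigma>_def flip: ereal_min)
qed

end
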